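(* Let $R$ be an arbitrary associative unitary ring, let $L:\mathrm{Mod}(R)\to \mathbb{R}_{\geq 0}\cup\{\infty\}$ be a length function, and let $M_\phi\in\mathrm{lFin}_L[X^{\pm1}]$. Then $$\mathrm{ent}_L(\phi)=\sup\{L(N/\phi^{-1}N): N\leq M \text{ an } R\text{-submodule},\ N=T(\phi^{-1},N),\ L(N/\phi^{-1}N)<\infty\}.$$
   Context: $\mathrm{Mod}(R)$ is the category of right $R$-modules. A function $L:\mathrm{Mod}(R)\to \mathbb{R}_{\geq 0}\cup\{\infty\}$ is a length function if: $L(0)=0$ and $L(M)=L(M')$ whenever $M\cong M'$; $L(M)=L(M')+L(M'')$ for every short exact sequence $0\to M'\to M\to M''\to 0$ (additive); and $L(M)=\sup\{L(F): F \text{ a finitely generated submodule of } M\}$ for all $M$ (upper continuous). A module $N$ is $L$-finite if $L(N)<\infty$; $\mathrm{Fin}_L(M)$ is the set of $L$-finite submodules of $M$. A module is locally $L$-finite if all its finitely generated submodules are $L$-finite. $M_\phi$, with $M$ a right $R$-module and $\phi\in\mathrm{End}_R(M)$, denotes the right $R[X]$-module with underlying $R$-module $M$ on which $X$ acts as $\phi$. $\mathrm{lFin}_L[X^{\pm1}]$ consists of the $M_\phi$ with $\phi$ an automorphism of $M$ and $M$ locally $L$-finite as an $R$-module. For an endomorphism $\psi$ of $M$ and an $R$-submodule $N\le M$, $T(\psi,N)=\sum_{i\ge 0}\psi^i(N)$; thus $N=T(\phi^{-1},N)$ means exactly $\phi^{-1}N\leq N$. For $N\in\mathrm{Fin}_L(M)$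 and $n\geq 1$ let $T_n(\phi,N)=\sum_{i=0}^{n-1}\phi^i(N)$ and $\mathrm{ent}_L(\phi,N)=\lim_{n\to\infty}L(T_n(\phi,N))/n$ (the limit exists and is finite). The algebraic $L$-entropy is $\mathrm{ent}_L(\phi)=\sup\{\mathrm{ent}_L(\phi,N): N\in\mathrm{Fin}_L(M)\}$. *)

theory Defs
  imports "HOL-Algebra.UnivPoly" "HOL-Library.Extended_Nonnegative_Real"
begin

section \<open>Right modules\<close>

text \<open>
  The library's \<^locale>\<open>module\<close> is restricted to commutative rings. We keep its record type, and
  \<open>r \<odot>\<^bsub>M\<^esub> x\<close> stands for \<open>x \<cdot> r\<close>. This explains the order of the factors in \<open>rsmult_assoc\<close>. The
  fields \<^const>\<open>mult\<close> and \<^const>\<open>one\<close> of the record carry no information.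
\<close>

locale right_module = R?: ring R + M?: abelian_group M
  for R :: "('r, 'b) ring_scheme" (structure) and M :: "('r, 'm) module" (structure) +
  assumes rsmult_closed [simp, intro]:
      "\<lbrakk>a \<in> carrier R; x \<in> carrier M\<rbrakk> \<Longrightarrow> a \<odot>\<^bsub>M\<^esub> x \<in> carrier M"
    and rsmult_l_distr:
      "\<lbrakk>a \<in> carrier R; b \<in> carrier R; x \<in> carrier M\<rbrakk> \<Longrightarrow>
      (a \<oplus>\<^bsub>R\<^esub> b) \<odot>\<^bsub>M\<^esub> x = (a \<odot>\<^bsub>M\<^esub> x) \<oplus>\<^bsub>M\<^esub> (b \<odot>\<^bsub>M\<^esub> x)"
    and rsmult_r_distr:
      "\<lbrakk>a \<in> carrier R; x \<in> carrier M; y \<in> carrier M\<rbrakk> \<Longrightarrow>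
      a \<odot>\<^bsub>M\<^esub> (x \<oplus>\<^bsub>M\<^esub> y) = (a \<odot>\<^bsub>M\<^esub> x) \<oplus>\<^bsub>M\<^esub> (a \<odot>\<^bsub>M\<^esub> y)"
    and rsmult_assoc:
      "\<lbrakk>a \<in> carrier R; b \<in> carrier R; x \<in> carrier M\<rbrakk> \<Longrightarrow>
      (a \<otimes>\<^bsub>R\<^esub> b) \<odot>\<^bsub>M\<^esub> x = b \<odot>\<^bsub>M\<^esub> (a \<odot>\<^bsub>M\<^esub> x)"
    and rsmult_one [simp]:
      "x \<in> carrier M \<Longrightarrow> \<one>\<^bsub>R\<^esub> \<odot>\<^bsub>M\<^esub> x = x"

definition rmod_hom ::
    "('r, 'b) ring_scheme \<Rightarrow> ('r, 'm) module \<Rightarrow> ('r, 'n) module \<Rightarrow> ('m \<Rightarrow> 'n) set" where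
  "rmod_hom R M N = {f. f \<in> carrier M \<rightarrow> carrier N \<and>
     (\<forall>x\<in>carrier M. \<forall>y\<in>carrier M. f (x \<oplus>\<^bsub>M\<^esub> y) = f x \<oplus>\<^bsub>N\<^esub> f y) \<and>
     (\<forall>r\<in>carrier R. \<forall>x\<in>carrier M. f (r \<odot>\<^bsub>M\<^esub> x) = r \<odot>\<^bsub>N\<^esub> f x)}"

abbreviation rmod_End :: "('r, 'b) ring_scheme \<Rightarrow> ('r, 'm) module \<Rightarrow> ('m \<Rightarrow> 'm) set" where
  "rmod_End R M \<equiv> rmod_hom R M M"

definition rmod_iso :: "('r, 'b) ring_scheme \<Rightarrow> ('r, 'm) module \<Rightarrow> ('r, 'n) module \<Rightarrow> bool" where
  "rmod_iso R M N \<longleftrightarrow> (\<exists>f\<in>rmod_hom R M N. bij_betw f (carrier M) (carrier N))"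

definition rmod_automorphism ::
    "('r, 'b) ring_scheme \<Rightarrow> ('r, 'm) module \<Rightarrow> ('m \<Rightarrow> 'm) \<Rightarrow> bool" where
  "rmod_automorphism R M \<phi> \<longleftrightarrow> \<phi> \<in> rmod_End R M \<and> bij_betw \<phi> (carrier M) (carrier M)"

definition submodule_span ::
    "('r, 'b) ring_scheme \<Rightarrow> ('r, 'm) module \<Rightarrow> 'm set \<Rightarrow> 'm set" where
  "submodule_span R M S = \<Inter>{H. submodule H R M \<and> S \<subseteq> H}"

definition fin_gen_submodule ::
    "('r, 'b) ring_scheme \<Rightarrow> ('r, 'm) module \<Rightarrow> 'm set \<Rightarrow> bool" where
  "fin_gen_submodule R M F \<longleftrightarrow> (\<exists>S. finite S \<and> S \<subseteq> carrier M \<and> F = submodule_span R M S)"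

abbreviation sub_module :: "('r, 'm) module \<Rightarrow> 'm set \<Rightarrow> ('r, 'm) module" where
  "sub_module M N \<equiv> M\<lparr>carrier := N\<rparr>"

text \<open>The scalar action on cosets is \<open>(K + x) \<cdot> r = K + x \<cdot> r\<close>.\<close>

definition quot_module :: "('r, 'm) module \<Rightarrow> 'm set \<Rightarrow> ('r, 'm set) module" where
  "quot_module M K = \<lparr>carrier = a_rcosets\<^bsub>M\<^esub> K, mult = undefined, one = undefined,
     zero = K, add = set_add M, smult = (\<lambda>r X. set_add M K ((\<lambda>x. r \<odot>\<^bsub>M\<^esub> x) ` X))\<rparr>"


section \<open>Length functions\<close>

text \<open>
  Right \<open>R\<close>-modules with carrier in a type \<open>'m\<close> play the role of \<open>Mod(R)\<close>.
\<close>

definition length_function ::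
    "('r, 'b) ring_scheme \<Rightarrow> (('r, 'm) module \<Rightarrow> ennreal) \<Rightarrow> bool" where
  "length_function R L \<longleftrightarrow>
     (\<forall>M. right_module R M \<longrightarrow> carrier M = {\<zero>\<^bsub>M\<^esub>} \<longrightarrow> L M = 0) \<and>
     (\<forall>M M'. right_module R M \<longrightarrow> right_module R M' \<longrightarrow> rmod_iso R M M' \<longrightarrow> L M = L M') \<and>
     (\<forall>M' M M'' f g. right_module R M' \<longrightarrow> right_module R M \<longrightarrow> right_module R M'' \<longrightarrow>
        f \<in> rmod_hom R M' M \<longrightarrow> g \<in> rmod_hom R M M'' \<longrightarrow>
        inj_on f (carrier M') \<longrightarrow> f ` carrier M' = {x \<in> carrier M. g x = \<zero>\<^bsub>M''\<^esub>} \<longrightarrow>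
        g ` carrier M = carrier M'' \<longrightarrow>
        L M = L M' + L M'') \<and>
     (\<forall>M. right_module R M \<longrightarrow>
        L M = Sup {L (sub_module M F) | F. fin_gen_submodule R M F})"

text \<open>
  A quotient \<open>M/K\<close> is built from cosets, so its carrier lies in \<open>'m set\<close> rather than \<open>'m\<close>. As \<open>L\<close> is
  invariant under isomorphism, its value at such a module is read off at any isomorphic copy with
  carrier in \<open>'m\<close>. The lemmas at the end of this theory show that quotients have such copies and
  that the result does not depend on the choice.
\<close>

definition length_of ::
    "('r, 'b) ring_scheme \<Rightarrow> (('r, 'm) module \<Rightarrow> ennreal) \<Rightarrow> ('r, 'q) module \<Rightarrow> ennreal" where
  "length_of R L Q = L (SOME Q'. right_module R Q' \<and> rmod_iso R Q Q')"

definition Fin_L ::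
    "('r, 'b) ring_scheme \<Rightarrow> (('r, 'm) module \<Rightarrow> ennreal) \<Rightarrow> ('r, 'm) module \<Rightarrow> 'm set set" where
  "Fin_L R L M = {N. submodule N R M \<and> L (sub_module M N) < \<infinity>}"

definition locally_L_finite ::
    "('r, 'b) ring_scheme \<Rightarrow> (('r, 'm) module \<Rightarrow> ennreal) \<Rightarrow> ('r, 'm) module \<Rightarrow> bool" where
  "locally_L_finite R L M \<longleftrightarrow> (\<forall>F. fin_gen_submodule R M F \<longrightarrow> L (sub_module M F) < \<infinity>)"


section \<open>The modules $M_\phi$ over the polynomial ring\<close>

text \<open>Since \<open>X\<close> acts as \<open>\<phi>\<close>, the polynomial \<open>\<Sum>i. p\<^sub>i X\<^sup>i\<close> sends \<open>x\<close> to \<open>\<Sum>i. \<phi>\<^sup>i (x \<cdot> p\<^sub>i)\<close>.\<close>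

definition poly_module ::
    "('r, 'b) ring_scheme \<Rightarrow> ('r, 'm) module \<Rightarrow> ('m \<Rightarrow> 'm) \<Rightarrow> (nat \<Rightarrow> 'r, 'm) module" where
  "poly_module R M \<phi> = \<lparr>carrier = carrier M, mult = mult M, one = one M, zero = zero M, add = add M,
     smult = (\<lambda>p x. \<Oplus>\<^bsub>M\<^esub>i\<in>{..deg R p}. (\<phi> ^^ i) (coeff (UP R) p i \<odot>\<^bsub>M\<^esub> x))\<rparr>"

definition lFin_X_inv ::
    "('r, 'b) ring_scheme \<Rightarrow> (('r, 'm) module \<Rightarrow> ennreal) \<Rightarrow> (nat \<Rightarrow> 'r, 'm) module set" where
  "lFin_X_inv R L = {poly_module R M \<phi> | M \<phi>.
     right_module R M \<and> rmod_automorphism R M \<phi> \<and> locally_L_finite R L M}"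


section \<open>Trajectories and entropy\<close>

text \<open>A sum of submodules is the submodule generated by their union.\<close>

definition traj ::
    "('r, 'b) ring_scheme \<Rightarrow> ('r, 'm) module \<Rightarrow> ('m \<Rightarrow> 'm) \<Rightarrow> 'm set \<Rightarrow> 'm set" where
  "traj R M \<psi> N = submodule_span R M (\<Union>i. (\<psi> ^^ i) ` N)"

definition traj_n ::
    "('r, 'b) ring_scheme \<Rightarrow> ('r, 'm) module \<Rightarrow> nat \<Rightarrow> ('m \<Rightarrow> 'm) \<Rightarrow> 'm set \<Rightarrow> 'm set" where
  "traj_n R M n \<phi> N = submodule_span R M (\<Union>i<n. (\<phi> ^^ i) ` N)"

definition ent_at ::
    "('r, 'b) ring_scheme \<Rightarrow> (('r, 'm) module \<Rightarrow> ennreal) \<Rightarrow> ('r, 'm) module \<Rightarrow> ('m \<Rightarrow> 'm) \<Rightarrow>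
     'm set \<Rightarrow> ennreal" where
  "ent_at R L M \<phi> N = lim (\<lambda>n. L (sub_module M (traj_n R M n \<phi> N)) / of_nat n)"

definition ent ::
    "('r, 'b) ring_scheme \<Rightarrow> (('r, 'm) module \<Rightarrow> ennreal) \<Rightarrow> ('r, 'm) module \<Rightarrow> ('m \<Rightarrow> 'm) \<Rightarrow>
     ennreal" where
  "ent R L M \<phi> = Sup {ent_at R L M \<phi> N | N. N \<in> Fin_L R L M}"

definition mod_inv :: "('r, 'm) module \<Rightarrow> ('m \<Rightarrow> 'm) \<Rightarrow> 'm \<Rightarrow> 'm" where
  "mod_inv M \<phi> = inv_into (carrier M) \<phi>"

section \<open>Copies of quotients inside the carrier type\<close>

lemma rmod_iso_sym:
  assumes "right_module R M" "right_module R N" "rmod_iso R M N"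
  shows "rmod_iso R N M"
proof -
  interpret M: right_module R M by fact
  obtain f where f: "f \<in> rmod_hom R M N" "bij_betw f (carrier M) (carrier N)"
    using assms(3) by (auto simp: rmod_iso_def)
  define g where "g = inv_into (carrier M) f"
  have g: "bij_betw g (carrier N) (carrier M)"
    unfolding g_def using f(2) by (rule bij_betw_inv_into)
  have gc: "g y \<in> carrier M" if "y \<in> carrier N" for y
    using g that by (auto simp: bij_betw_def)
  have fg: "f (g y) = y" if "y \<in> carrier N" for y
    unfolding g_def using f(2) that by (simp add: bij_betw_inv_into_right)
  have gf: "g (f x) = x" if "x \<in> carrier M" for x
    unfolding g_def using f(2) that by (simp add: bij_betw_inv_into_left)
  have "g (x \<oplus>\<^bsub>N\<^esub> y) = g x \<oplus>\<^bsub>M\<^esub> g y" if "x \<in> carrier N" "y \<in> carrier N" for x y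
  proof -
    have "f (g x \<oplus>\<^bsub>M\<^esub> g y) = x \<oplus>\<^bsub>N\<^esub> y"
      using f(1) that gc fg by (simp add: rmod_hom_def)
    then show ?thesis using gf[of "g x \<oplus>\<^bsub>M\<^esub> g y"] gc that by simp
  qed
  moreover have "g (r \<odot>\<^bsub>N\<^esub> y) = r \<odot>\<^bsub>M\<^esub> g y" if "r \<in> carrier R" "y \<in> carrier N" for r y
  proof -
    have "f (r \<odot>\<^bsub>M\<^esub> g y) = r \<odot>\<^bsub>N\<^esub> y"
      using f(1) that gc fg by (simp add: rmod_hom_def)
    then show ?thesis using gf[of "r \<odot>\<^bsub>M\<^esub> g y"] gc that by simp
  qed
  ultimately have "g \<in> rmod_hom R N M"
    using gc by (simp add: rmod_hom_def)
  then show ?thesis using g by (auto simp: rmod_iso_def)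
qed

lemma rmod_iso_trans:
  assumes "rmod_iso R M N" "rmod_iso R N P"
  shows "rmod_iso R M P"
proof -
  obtain f g where f: "f \<in> rmod_hom R M N" "bij_betw f (carrier M) (carrier N)"
    and g: "g \<in> rmod_hom R N P" "bij_betw g (carrier N) (carrier P)"
    using assms by (auto simp: rmod_iso_def)
  have "g \<circ> f \<in> rmod_hom R M P"
    using f(1) g(1) by (auto simp: rmod_hom_def Pi_iff)
  moreover have "bij_betw (g \<circ> f) (carrier M) (carrier P)"
    using f(2) g(2) by (rule bij_betw_trans)
  ultimately show ?thesis by (auto simp: rmod_iso_def)
qed

lemma length_of_eq:
  fixes L :: "('r, 'm) module \<Rightarrow> ennreal" and Q' :: "('r, 'm) module"
  assumes "length_function R L" "right_module R Q" "right_module R Q'" "rmod_iso R Q Q'"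
  shows "length_of R L Q = L Q'"
proof -
  define S :: "('r, 'm) module" where "S = (SOME Q'. right_module R Q' \<and> rmod_iso R Q Q')"
  have S: "right_module R S \<and> rmod_iso R Q S"
    unfolding S_def by (rule someI[of _ Q']) (use assms in blast)
  then have "rmod_iso R S Q'"
    using rmod_iso_trans rmod_iso_sym assms by blast
  then have "L S = L Q'"
    using assms(1,3) S by (simp add: length_function_def)
  then show ?thesis by (simp add: length_of_def S_def)
qed

lemma length_of_same_type:
  assumes "length_function R L" "right_module R M"
  shows "length_of R L M = L M"
proof (rule length_of_eq[OF assms assms(2)])
  have "id \<in> rmod_hom R M M" by (simp add: rmod_hom_def)
  then show "rmod_iso R M M" unfolding rmod_iso_def using bij_betw_id by blast
qed

lemma right_module_copy:
  fixes Q :: "('r, 'q) module" and h :: "'q \<Rightarrow> 'm"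
  assumes "right_module R Q" "inj_on h (carrier Q)"
  shows "\<exists>Q' :: ('r, 'm) module. right_module R Q' \<and> rmod_iso R Q Q'"
proof -
  interpret Q: right_module R Q by fact
  define g where "g = inv_into (carrier Q) h"
  have gh [simp]: "g (h x) = x" if "x \<in> carrier Q" for x
    unfolding g_def using assms(2) that by simp
  define Q' :: "('r, 'm) module" where
    "Q' = \<lparr>carrier = h ` carrier Q, mult = undefined, one = undefined, zero = h \<zero>\<^bsub>Q\<^esub>,
       add = (\<lambda>x y. h (g x \<oplus>\<^bsub>Q\<^esub> g y)), smult = (\<lambda>r x. h (r \<odot>\<^bsub>Q\<^esub> g x))\<rparr>"
  have "abelian_group Q'"
  proof (rule abelian_groupI)
    fix x assume "x \<in> carrier Q'"
    then obtain u where u: "u \<in> carrier Q" "x = h u" by (auto simp: Q'_def)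
    show "\<exists>y\<in>carrier Q'. y \<oplus>\<^bsub>Q'\<^esub> x = \<zero>\<^bsub>Q'\<^esub>"
      by (rule bexI[of _ "h (\<ominus>\<^bsub>Q\<^esub> u)"]) (use u in \<open>auto simp: Q'_def Q.M.l_neg\<close>)
  qed (auto simp: Q'_def Q.M.a_ac)
  then have "right_module R Q'"
    by (intro right_module.intro right_module_axioms.intro Q.R.ring_axioms)
      (auto simp: Q'_def Q.rsmult_l_distr Q.rsmult_r_distr Q.rsmult_assoc)
  moreover have "h \<in> rmod_hom R Q Q'" "bij_betw h (carrier Q) (carrier Q')"
    using assms(2) by (auto simp: rmod_hom_def Q'_def bij_betw_def)
  ultimately show ?thesis by (auto simp: rmod_iso_def)
qed

lemma carrier_quot_module: "carrier (quot_module M K) = a_r_coset M K ` carrier M"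
  unfolding quot_module_def A_RCOSETS_def' by auto

lemma right_module_quot:
  assumes "right_module R M" "submodule K R M"
  shows "right_module R (quot_module M K)"
proof -
  interpret M: right_module R M by fact
  interpret K: submodule K R M by fact
  interpret K: abelian_subgroup K M
    by (rule abelian_subgroupI3)
      (auto intro: additive_subgroup.intro K.subgroup_axioms M.M.abelian_group_axioms)
  have KK: "K \<subseteq> carrier M" using K.a_subset .
  have scal: "set_add M K ((\<lambda>x. r \<odot>\<^bsub>M\<^esub> x) ` (a_r_coset M K u)) = a_r_coset M K (r \<odot>\<^bsub>M\<^esub> u)"
    if r: "r \<in> carrier R" and u: "u \<in> carrier M" for r u
  proof -
    have ru: "r \<odot>\<^bsub>M\<^esub> u \<in> carrier M" using r u by simp
    have z: "\<zero>\<^bsub>M\<^esub> \<in> K" by simp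
    show ?thesis
    proof (rule Set.set_eqI, rule iffI)
      fix y assume "y \<in> set_add M K ((\<lambda>x. r \<odot>\<^bsub>M\<^esub> x) ` (a_r_coset M K u))"
      then obtain k l where kl: "k \<in> K" "l \<in> K" "y = k \<oplus>\<^bsub>M\<^esub> (r \<odot>\<^bsub>M\<^esub> (l \<oplus>\<^bsub>M\<^esub> u))"
        by (auto simp: set_add_def' a_r_coset_def')
      have c: "k \<in> carrier M" "l \<in> carrier M" using kl KK by auto
      have "y = (k \<oplus>\<^bsub>M\<^esub> (r \<odot>\<^bsub>M\<^esub> l)) \<oplus>\<^bsub>M\<^esub> (r \<odot>\<^bsub>M\<^esub> u)"
        using kl(3) c r u by (simp add: M.rsmult_r_distr M.M.a_assoc)
      moreover have "k \<oplus>\<^bsub>M\<^esub> (r \<odot>\<^bsub>M\<^esub> l) \<in> K"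
        using kl r K.smult_closed K.a_closed by blast
      ultimately show "y \<in> a_r_coset M K (r \<odot>\<^bsub>M\<^esub> u)"
        by (auto simp: a_r_coset_def')
    next
      fix y assume "y \<in> a_r_coset M K (r \<odot>\<^bsub>M\<^esub> u)"
      then obtain k where k: "k \<in> K" "y = k \<oplus>\<^bsub>M\<^esub> (r \<odot>\<^bsub>M\<^esub> u)"
        by (auto simp: a_r_coset_def')
      have "u \<in> a_r_coset M K u" using z u by (force simp: a_r_coset_def')
      then show "y \<in> set_add M K ((\<lambda>x. r \<odot>\<^bsub>M\<^esub> x) ` (a_r_coset M K u))"
        using k by (auto simp: set_add_def')
    qed
  qed
  have add: "set_add M (a_r_coset M K u) (a_r_coset M K v) = a_r_coset M K (u \<oplus>\<^bsub>M\<^esub> v)"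
    if "u \<in> carrier M" "v \<in> carrier M" for u v
    using that by (rule K.a_rcos_sum)
  have car: "carrier (quot_module M K) = a_r_coset M K ` carrier M"
    by (rule carrier_quot_module)
  have zr: "K = a_r_coset M K \<zero>\<^bsub>M\<^esub>"
    using KK by (simp add: M.M.a_coset_add_zero)
  have zr': "zero (quot_module M K) = a_r_coset M K \<zero>\<^bsub>M\<^esub>"
    using zr by (simp add: quot_module_def)
  have addq: "add (quot_module M K) = set_add M"
    by (simp add: quot_module_def)
  have smq: "r \<odot>\<^bsub>quot_module M K\<^esub> a_r_coset M K u = a_r_coset M K (r \<odot>\<^bsub>M\<^esub> u)"
    if "r \<in> carrier R" "u \<in> carrier M" for r u
    using scal[OF that] by (simp add: quot_module_def)
  have "abelian_group (quot_module M K)"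
  proof (rule abelian_groupI)
    fix X assume "X \<in> carrier (quot_module M K)"
    then obtain u where u: "u \<in> carrier M" "X = a_r_coset M K u" by (auto simp: car)
    show "\<exists>Y\<in>carrier (quot_module M K). Y \<oplus>\<^bsub>quot_module M K\<^esub> X = \<zero>\<^bsub>quot_module M K\<^esub>"
      by (rule bexI[of _ "a_r_coset M K (\<ominus>\<^bsub>M\<^esub> u)"])
        (use u in \<open>auto simp: car zr' addq add M.M.l_neg\<close>)
  qed (auto simp: car zr' addq add M.M.a_ac)
  then show ?thesis
    by (intro right_module.intro right_module_axioms.intro M.R.ring_axioms)
      (auto simp: car addq smq add M.rsmult_l_distr M.rsmult_r_distr M.rsmult_assoc)
qed

lemma quot_module_copy:
  fixes M :: "('r, 'm) module"
  assumes "right_module R M" "submodule K R M"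
  shows "\<exists>Q' :: ('r, 'm) module. right_module R Q' \<and> rmod_iso R (quot_module M K) Q'"
proof (rule right_module_copy[OF right_module_quot[OF assms]])
  interpret M: right_module R M by fact
  interpret K: submodule K R M by fact
  interpret K: abelian_subgroup K M
    by (rule abelian_subgroupI3)
      (auto intro: additive_subgroup.intro K.subgroup_axioms M.M.abelian_group_axioms)
  let ?h = "\<lambda>X. SOME x. x \<in> X"
  show "inj_on ?h (carrier (quot_module M K))"
  proof (rule inj_onI)
    fix X Y
    assume XY: "X \<in> carrier (quot_module M K)" "Y \<in> carrier (quot_module M K)" "?h X = ?h Y"
    have rep: "\<exists>u\<in>carrier M. Z = a_r_coset M K u \<and> ?h Z \<in> Z"
      if Z: "Z \<in> carrier (quot_module M K)" for Z
    proof -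
      obtain u where u: "u \<in> carrier M" "Z = a_r_coset M K u"
        using Z by (auto simp: carrier_quot_module)
      then have "u \<in> Z" using K.a_rcos_self by simp
      then show ?thesis using u someI[of "\<lambda>x. x \<in> Z"] by blast
    qed
    show "X = Y"
      using rep[OF XY(1)] rep[OF XY(2)] XY(3) by (metis K.a_repr_independence')
  qed
qed

end

theory Submission
  imports Defs
begin

text \<open>
  Let \<open>F\<close> be an \<open>L\<close>-finite submodule, \<open>\<psi> = \<phi>\<^sup>-\<^sup>1\<close>, \<open>T\<^sub>n = T\<^sub>n(\<psi>, F)\<close> and \<open>N = T(\<psi>, F)\<close>. Since
  \<open>T\<^sub>n\<^sub>+\<^sub>1 = F + \<psi> T\<^sub>n\<close> and \<open>L(\<psi> T\<^sub>n) = L(T\<^sub>n)\<close>, the second isomorphism theorem gives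
  \<open>L(T\<^sub>n\<^sub>+\<^sub>1) - L(T\<^sub>n) = L(F) - L(F \<inter> \<psi> T\<^sub>n)\<close>. By upper continuity this tends to
  \<open>L(F) - L(F \<inter> \<psi> N) = L(N/\<psi> N)\<close>, which is therefore also the limit of the averages
  \<open>L(T\<^sub>n)/n\<close>, that is \<open>ent\<^sub>L(\<phi>, F)\<close>.
  Conversely, let \<open>\<psi> N \<le> N\<close>. By upper continuity \<open>L(N/\<psi> N)\<close> is the supremum of
  \<open>L(F/(F \<inter> \<psi> N))\<close> over the finitely generated \<open>F \<le> N\<close>. Such an \<open>F\<close> is \<open>L\<close>-finite and
  \<open>T(\<psi>, F) \<le> N\<close>, so that \<open>L(F/(F \<inter> \<psi> N)) \<le> L(F/(F \<inter> \<psi> T(\<psi>, F))) = ent\<^sub>L(\<phi>, F)\<close>.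
\<close>

section \<open>Averages of a real sequence with convergent increments\<close>

text \<open>Beyond some index each increment differs from \<open>c\<close> by less than
  \<open>e / 2\<close>, so \<open>t n - n * c\<close> grows by at most \<open>e / 2\<close> per
  step. The constant accumulated up to that index is negligible after division by
  \<open>n\<close>.\<close>

lemma cesaro_increments:
  fixes t :: "nat \<Rightarrow> real"
  assumes "(\<lambda>n. t (Suc n) - t n) \<longlonglongrightarrow> c"
  shows "(\<lambda>n. t n / real n) \<longlonglongrightarrow> c"
proof (rule LIMSEQ_I)
  fix e :: real assume e: "0 < e"
  obtain N where N: "\<And>n. n \<ge> N \<Longrightarrow> \<bar>t (Suc n) - t n - c\<bar> < e / 2"
    using LIMSEQ_D[OF assms, of "e / 2"] e by auto
  define C where "C = \<bar>t N - real N * c\<bar>"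
  have *: "\<bar>t n - real n * c\<bar> \<le> C + real (n - N) * (e / 2)" if "n \<ge> N" for n
    using that
  proof (induction n rule: dec_induct)
    case base
    then show ?case by (simp add: C_def)
  next
    case (step n)
    have "\<bar>t (Suc n) - real (Suc n) * c\<bar> \<le> \<bar>t n - real n * c\<bar> + \<bar>t (Suc n) - t n - c\<bar>"
      by (simp add: algebra_simps)
    also have "\<dots> \<le> C + real (n - N) * (e / 2) + e / 2"
      using step N[of n] by simp
    finally show ?case using step(1) by (simp add: Suc_diff_le distrib_right add_divide_distrib)
  qed
  \<comment> \<open>For \<open>n > K\<close> the initial error \<open>C\<close> is less than
    \<open>n * (e / 2)\<close>; the drift contributes at most the other half.\<close>
  obtain K :: nat where K: "real K > 2 * C / e" using reals_Archimedean2 by blast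
  have "norm (t n / real n - c) < e" if n: "n \<ge> Suc (max N K)" for n
  proof -
    have n0: "real n > 0" "n \<ge> N" and "real n > 2 * C / e" using n K by auto
    then have "C < real n * (e / 2)" using e by (simp add: field_simps)
    moreover have "real (n - N) * (e / 2) \<le> real n * (e / 2)" using e by (simp add: mult_right_mono)
    ultimately have "\<bar>t n - real n * c\<bar> < real n * e" using *[OF n0(2)] by simp
    moreover have "t n / real n - c = (t n - real n * c) / real n" using n0 by (simp add: field_simps)
    ultimately show ?thesis using n0 by (simp add: field_simps)
  qed
  then show "\<exists>no. \<forall>n\<ge>no. norm (t n / real n - c) < e" by blast
qed

text \<open>Finiteness matters because \<open>enn2real\<close> sends \<open>\<infinity>\<close> to
  0.\<close>

lemma enn2real_add:
  "a < \<infinity> \<Longrightarrow> b < \<infinity> \<Longrightarrow> enn2real (a + b) = enn2real a + enn2real b"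
  by (cases a; cases b) (auto simp flip: ennreal_plus)

section \<open>Submodules and homomorphisms of right modules\<close>

context right_module
begin

lemma zero_smult: "x \<in> carrier M \<Longrightarrow> \<zero>\<^bsub>R\<^esub> \<odot>\<^bsub>M\<^esub> x = \<zero>\<^bsub>M\<^esub>"
  using rsmult_l_distr[of "\<zero>\<^bsub>R\<^esub>" "\<zero>\<^bsub>R\<^esub>" x] by simp

lemma smult_minus_one:
  assumes "x \<in> carrier M"
  shows "(\<ominus>\<^bsub>R\<^esub> \<one>\<^bsub>R\<^esub>) \<odot>\<^bsub>M\<^esub> x = \<ominus>\<^bsub>M\<^esub> x"
proof -
  have "((\<ominus>\<^bsub>R\<^esub> \<one>\<^bsub>R\<^esub>) \<odot>\<^bsub>M\<^esub> x) \<oplus>\<^bsub>M\<^esub> x = (\<ominus>\<^bsub>R\<^esub> \<one>\<^bsub>R\<^esub> \<oplus>\<^bsub>R\<^esub> \<one>\<^bsub>R\<^esub>) \<odot>\<^bsub>M\<^esub> x"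
    using assms by (simp add: rsmult_l_distr)
  also have "\<dots> = \<zero>\<^bsub>M\<^esub>" using assms by (simp add: zero_smult R.l_neg)
  finally show ?thesis using assms by (metis M.minus_equality R.a_inv_closed R.one_closed rsmult_closed)
qed

text \<open>The additive subgroup condition asks for inverses as well; these are supplied by the
  action of -1.\<close>

lemma submodule_iff:
  "submodule H R M \<longleftrightarrow> H \<subseteq> carrier M \<and> \<zero>\<^bsub>M\<^esub> \<in> H \<and>
    (\<forall>x\<in>H. \<forall>y\<in>H. x \<oplus>\<^bsub>M\<^esub> y \<in> H) \<and> (\<forall>r\<in>carrier R. \<forall>x\<in>H. r \<odot>\<^bsub>M\<^esub> x \<in> H)"
  (is "_ \<longleftrightarrow> ?rhs")
proof
  assume "submodule H R M"
  then interpret H: submodule H R M .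
  show ?rhs using H.subset H.one_closed H.m_closed by auto
next
  assume H: ?rhs
  have "\<ominus>\<^bsub>M\<^esub> x \<in> H" if "x \<in> H" for x
    using H that smult_minus_one[of x] by (metis R.a_inv_closed R.one_closed subsetD)
  then show "submodule H R M"
    using H by (intro submodule.intro subgroup.intro submodule_axioms.intro) (auto simp: a_inv_def)
qed

lemma submodule_minus: "submodule H R M \<Longrightarrow> x \<in> H \<Longrightarrow> \<ominus>\<^bsub>M\<^esub> x \<in> H"
  using smult_minus_one[of x] by (metis submodule_iff R.a_inv_closed R.one_closed subsetD)

lemma submodule_carrier: "submodule (carrier M) R M"
  by (simp add: submodule_iff)

lemma submodule_Int: "submodule H R M \<Longrightarrow> submodule K R M \<Longrightarrow> submodule (H \<inter> K) R M"
  by (auto simp: submodule_iff)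

lemma submodule_span_submodule: "S \<subseteq> carrier M \<Longrightarrow> submodule (submodule_span R M S) R M"
  using submodule_carrier unfolding submodule_span_def
  by (subst submodule_iff) (auto simp: submodule_iff)

lemma submodule_span_superset: "S \<subseteq> submodule_span R M S"
  by (auto simp: submodule_span_def)

lemma submodule_span_minimal: "submodule H R M \<Longrightarrow> S \<subseteq> H \<Longrightarrow> submodule_span R M S \<subseteq> H"
  by (auto simp: submodule_span_def)

lemma submodule_set_add:
  assumes "submodule H R M" "submodule K R M"
  shows "submodule (set_add M H K) R M"
  unfolding submodule_iff
proof (intro conjI ballI)
  have c: "H \<subseteq> carrier M" "K \<subseteq> carrier M" "\<zero>\<^bsub>M\<^esub> \<in> H" "\<zero>\<^bsub>M\<^esub> \<in> K"
    using assms by (auto simp: submodule_iff)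
  show "set_add M H K \<subseteq> carrier M" using c by (auto simp: set_add_def')
  show "\<zero>\<^bsub>M\<^esub> \<in> set_add M H K" using c by (force simp: set_add_def')
  fix x assume "x \<in> set_add M H K"
  then obtain h k where x: "h \<in> H" "k \<in> K" "x = h \<oplus>\<^bsub>M\<^esub> k" by (auto simp: set_add_def')
  { fix y assume "y \<in> set_add M H K"
    then obtain h' k' where y: "h' \<in> H" "k' \<in> K" "y = h' \<oplus>\<^bsub>M\<^esub> k'" by (auto simp: set_add_def')
    have "x \<oplus>\<^bsub>M\<^esub> y = (h \<oplus>\<^bsub>M\<^esub> h') \<oplus>\<^bsub>M\<^esub> (k \<oplus>\<^bsub>M\<^esub> k')"
      using x y c by (simp add: M.a_ac subset_eq)
    moreover have "h \<oplus>\<^bsub>M\<^esub> h' \<in> H" "k \<oplus>\<^bsub>M\<^esub> k' \<in> K" using assms x y by (auto simp: submodule_iff)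
    ultimately show "x \<oplus>\<^bsub>M\<^esub> y \<in> set_add M H K" by (auto simp: set_add_def') }
  fix r assume r: "r \<in> carrier R"
  have "r \<odot>\<^bsub>M\<^esub> x = (r \<odot>\<^bsub>M\<^esub> h) \<oplus>\<^bsub>M\<^esub> (r \<odot>\<^bsub>M\<^esub> k)"
    using x c r by (simp add: rsmult_r_distr subset_eq)
  moreover have "r \<odot>\<^bsub>M\<^esub> h \<in> H" "r \<odot>\<^bsub>M\<^esub> k \<in> K" using assms x r by (auto simp: submodule_iff)
  ultimately show "r \<odot>\<^bsub>M\<^esub> x \<in> set_add M H K" by (auto simp: set_add_def')
qed

lemma set_add_superset:
  assumes "submodule H R M" "submodule K R M"
  shows "H \<subseteq> set_add M H K" "K \<subseteq> set_add M H K"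
proof -
  have c: "H \<subseteq> carrier M" "K \<subseteq> carrier M" "\<zero>\<^bsub>M\<^esub> \<in> H" "\<zero>\<^bsub>M\<^esub> \<in> K"
    using assms by (auto simp: submodule_iff)
  show "H \<subseteq> set_add M H K"
  proof
    fix h assume "h \<in> H"
    moreover from this have "h = h \<oplus>\<^bsub>M\<^esub> \<zero>\<^bsub>M\<^esub>" using c by auto
    ultimately show "h \<in> set_add M H K" unfolding set_add_def' using c by blast
  qed
  show "K \<subseteq> set_add M H K"
  proof
    fix k assume "k \<in> K"
    moreover from this have "k = \<zero>\<^bsub>M\<^esub> \<oplus>\<^bsub>M\<^esub> k" using c by auto
    ultimately show "k \<in> set_add M H K" unfolding set_add_def' using c by blast
  qed
qed

lemma set_add_minimal:
  "submodule N R M \<Longrightarrow> H \<subseteq> N \<Longrightarrow> K \<subseteq> N \<Longrightarrow> set_add M H K \<subseteq> N"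
  unfolding submodule_iff set_add_def' by blast

lemma submodule_span_Un:
  assumes "S \<subseteq> carrier M" "T \<subseteq> carrier M"
  shows "submodule_span R M (S \<union> T) = set_add M (submodule_span R M S) (submodule_span R M T)"
proof
  have s: "submodule (submodule_span R M S) R M" "submodule (submodule_span R M T) R M"
    using assms by (auto intro: submodule_span_submodule)
  show "submodule_span R M (S \<union> T) \<subseteq> set_add M (submodule_span R M S) (submodule_span R M T)"
    by (rule submodule_span_minimal[OF submodule_set_add[OF s]])
      (use set_add_superset[OF s] submodule_span_superset in blast)
  show "set_add M (submodule_span R M S) (submodule_span R M T) \<subseteq> submodule_span R M (S \<union> T)"
    by (rule set_add_minimal[OF submodule_span_submodule]) (use assms in \<open>auto simp: submodule_span_def\<close>)
qed

lemma submodule_span_of_submodule: "submodule H R M \<Longrightarrow> submodule_span R M H = H"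
  by (simp add: subset_antisym submodule_span_minimal submodule_span_superset)

section \<open>Submodules as modules in their own right\<close>

lemma right_module_sub:
  assumes "submodule N R M"
  shows "right_module R (sub_module M N)"
proof -
  have N: "N \<subseteq> carrier M" "\<zero>\<^bsub>M\<^esub> \<in> N" "\<And>x y. x \<in> N \<Longrightarrow> y \<in> N \<Longrightarrow> x \<oplus>\<^bsub>M\<^esub> y \<in> N"
    "\<And>r x. r \<in> carrier R \<Longrightarrow> x \<in> N \<Longrightarrow> r \<odot>\<^bsub>M\<^esub> x \<in> N"
    using assms by (auto simp: submodule_iff)
  have c: "x \<in> carrier M" if "x \<in> N" for x using that N by auto
  have "abelian_group (sub_module M N)"
  proof (rule abelian_groupI)
    fix x assume "x \<in> carrier (sub_module M N)"
    then show "\<exists>y\<in>carrier (sub_module M N). y \<oplus>\<^bsub>sub_module M N\<^esub> x = \<zero>\<^bsub>sub_module M N\<^esub>"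
      using submodule_minus[OF assms] c by (auto intro!: bexI[of _ "\<ominus>\<^bsub>M\<^esub> x"] simp: M.l_neg)
  qed (auto simp: N c M.a_ac)
  then show ?thesis
    by (intro right_module.intro right_module_axioms.intro R.ring_axioms)
      (auto simp: N c rsmult_l_distr rsmult_r_distr rsmult_assoc)
qed

lemma submodule_sub_module_iff:
  assumes "submodule N R M"
  shows "submodule K R (sub_module M N) \<longleftrightarrow> submodule K R M \<and> K \<subseteq> N"
proof -
  interpret N: right_module R "sub_module M N" by (rule right_module_sub[OF assms])
  show ?thesis using assms unfolding N.submodule_iff submodule_iff by auto
qed

text \<open>The two spans are intersections over different families, but the span in
  \<open>M\<close> lies inside \<open>N\<close> and hence belongs to both. Finite generation
  therefore means the same in \<open>N\<close> as in \<open>M\<close>.\<close>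

lemma submodule_span_sub_module:
  assumes "submodule N R M" "S \<subseteq> N"
  shows "submodule_span R (sub_module M N) S = submodule_span R M S"
proof -
  have "submodule (submodule_span R M S) R M" "submodule_span R M S \<subseteq> N"
    using assms submodule_span_submodule[of S] submodule_span_minimal[of N S]
    by (auto simp: submodule_iff)
  then show ?thesis
    using submodule_span_superset[of S]
    unfolding submodule_span_def submodule_sub_module_iff[OF assms(1)] by blast
qed

section \<open>Homomorphisms, chains and the canonical projection\<close>

lemma hom_zero:
  assumes "right_module R Q" "f \<in> rmod_hom R M Q"
  shows "f \<zero>\<^bsub>M\<^esub> = \<zero>\<^bsub>Q\<^esub>"
proof -
  interpret Q: right_module R Q by fact
  have "f \<zero>\<^bsub>M\<^esub> \<in> carrier Q" "f (\<zero>\<^bsub>R\<^esub> \<odot>\<^bsub>M\<^esub> \<zero>\<^bsub>M\<^esub>) = \<zero>\<^bsub>R\<^esub> \<odot>\<^bsub>Q\<^esub> f \<zero>\<^bsub>M\<^esub>"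
    using assms(2) R.zero_closed M.zero_closed unfolding rmod_hom_def by blast+
  then show ?thesis by (simp add: zero_smult Q.zero_smult)
qed

lemma hom_image_submodule:
  assumes "right_module R Q" "f \<in> rmod_hom R M Q" "submodule H R M"
  shows "submodule (f ` H) R Q"
proof -
  interpret Q: right_module R Q by fact
  have f: "\<And>x. x \<in> carrier M \<Longrightarrow> f x \<in> carrier Q"
    "\<And>x y. x \<in> carrier M \<Longrightarrow> y \<in> carrier M \<Longrightarrow> f x \<oplus>\<^bsub>Q\<^esub> f y = f (x \<oplus>\<^bsub>M\<^esub> y)"
    "\<And>r x. r \<in> carrier R \<Longrightarrow> x \<in> carrier M \<Longrightarrow> r \<odot>\<^bsub>Q\<^esub> f x = f (r \<odot>\<^bsub>M\<^esub> x)"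
    using assms(2) unfolding rmod_hom_def by auto
  have H: "H \<subseteq> carrier M" "\<zero>\<^bsub>M\<^esub> \<in> H" "\<And>x y. x \<in> H \<Longrightarrow> y \<in> H \<Longrightarrow> x \<oplus>\<^bsub>M\<^esub> y \<in> H"
    "\<And>r x. r \<in> carrier R \<Longrightarrow> x \<in> H \<Longrightarrow> r \<odot>\<^bsub>M\<^esub> x \<in> H"
    using assms(3) by (auto simp: submodule_iff)
  have "\<zero>\<^bsub>Q\<^esub> \<in> f ` H" using hom_zero[OF assms(1,2)] H(2) by (metis imageI)
  then show ?thesis unfolding Q.submodule_iff using f H by (auto simp: subset_iff)
qed

lemma hom_preimage_submodule:
  assumes "right_module R Q" "f \<in> rmod_hom R M Q" "submodule H R Q"
  shows "submodule {x \<in> carrier M. f x \<in> H} R M"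
proof -
  interpret Q: right_module R Q by fact
  show ?thesis
    using assms(2,3) hom_zero[OF assms(1,2)]
    unfolding submodule_iff Q.submodule_iff rmod_hom_def by auto
qed

text \<open>Each inclusion is the minimality of a span: the image of the span is a submodule
  containing \<open>f\<close> S\<open>, and the preimage of the span of\<close>f \<open>S\<close> is
  a submodule containing \<open>S\<close>.\<close>

lemma hom_image_span:
  assumes "right_module R Q" "f \<in> rmod_hom R M Q" "S \<subseteq> carrier M"
  shows "f ` submodule_span R M S = submodule_span R Q (f ` S)"
proof
  interpret Q: right_module R Q by fact
  have fS: "f ` S \<subseteq> carrier Q" using assms(2,3) unfolding rmod_hom_def by auto
  show "submodule_span R Q (f ` S) \<subseteq> f ` submodule_span R M S"
    by (rule Q.submodule_span_minimal[OF hom_image_submodule[OF assms(1,2) submodule_span_submodule[OF assms(3)]]])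
      (use submodule_span_superset in blast)
  have "submodule_span R M S \<subseteq> {x \<in> carrier M. f x \<in> submodule_span R Q (f ` S)}"
    by (rule submodule_span_minimal[OF hom_preimage_submodule[OF assms(1,2) Q.submodule_span_submodule[OF fS]]])
      (use Q.submodule_span_superset[of "f ` S"] assms(3) in blast)
  then show "f ` submodule_span R M S \<subseteq> submodule_span R Q (f ` S)" by blast
qed

lemma hom_restrict:
  assumes "f \<in> rmod_hom R M Q" "submodule H R M"
  shows "f \<in> rmod_hom R (sub_module M H) (sub_module Q (f ` H))"
  using assms unfolding rmod_hom_def submodule_iff by (auto simp: subset_iff)

lemma submodule_chain_Union:
  assumes "\<And>n. submodule (S n) R M" "incseq S"
  shows "submodule (\<Union>n::nat. S n) R M"
  unfolding submodule_iff
proof (intro conjI ballI)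
  show "(\<Union>n. S n) \<subseteq> carrier M" "\<zero>\<^bsub>M\<^esub> \<in> (\<Union>n. S n)" using assms(1)[unfolded submodule_iff] by blast+
  fix x assume "x \<in> (\<Union>n. S n)"
  then obtain i where i: "x \<in> S i" by auto
  { fix y assume "y \<in> (\<Union>n. S n)"
    then obtain j where j: "y \<in> S j" by auto
    have "x \<in> S (max i j)" "y \<in> S (max i j)"
      using i j incseqD[OF assms(2), of i "max i j"] incseqD[OF assms(2), of j "max i j"] by auto
    then show "x \<oplus>\<^bsub>M\<^esub> y \<in> (\<Union>n. S n)" using assms(1)[of "max i j"] by (auto simp: submodule_iff) }
  fix r assume "r \<in> carrier R"
  then show "r \<odot>\<^bsub>M\<^esub> x \<in> (\<Union>n. S n)" using assms(1)[of i, unfolded submodule_iff] i by blast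
qed

text \<open>Multiplying every element of the coset of \<open>u\<close> by \<open>r\<close> may give
  only part of the coset of \<open>r \<odot> u\<close>; adding \<open>K\<close> fills it up. This
  makes the coset map linear, with kernel \<open>K\<close>.\<close>

lemma quot_module_hom:
  assumes "submodule K R M"
  shows "a_r_coset M K \<in> rmod_hom R M (quot_module M K)"
    and "x \<in> carrier M \<Longrightarrow> a_r_coset M K x = \<zero>\<^bsub>quot_module M K\<^esub> \<longleftrightarrow> x \<in> K"
proof -
  interpret K: submodule K R M by fact
  interpret K: abelian_subgroup K M
    by (rule abelian_subgroupI3)
      (auto intro: additive_subgroup.intro K.subgroup_axioms M.abelian_group_axioms)
  have "set_add M K ((\<lambda>x. r \<odot>\<^bsub>M\<^esub> x) ` (a_r_coset M K u)) = a_r_coset M K (r \<odot>\<^bsub>M\<^esub> u)"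
    if r: "r \<in> carrier R" and u: "u \<in> carrier M" for r u
  proof (intro equalityI subsetI)
    fix y assume "y \<in> set_add M K ((\<lambda>x. r \<odot>\<^bsub>M\<^esub> x) ` (a_r_coset M K u))"
    then obtain k l where kl: "k \<in> K" "l \<in> K" "y = k \<oplus>\<^bsub>M\<^esub> (r \<odot>\<^bsub>M\<^esub> (l \<oplus>\<^bsub>M\<^esub> u))"
      by (auto simp: set_add_def' a_r_coset_def')
    then have "y = (k \<oplus>\<^bsub>M\<^esub> (r \<odot>\<^bsub>M\<^esub> l)) \<oplus>\<^bsub>M\<^esub> (r \<odot>\<^bsub>M\<^esub> u)"
      using r u by (simp add: rsmult_r_distr M.a_assoc)
    moreover have "k \<oplus>\<^bsub>M\<^esub> (r \<odot>\<^bsub>M\<^esub> l) \<in> K"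
      using kl r K.smult_closed K.a_closed by blast
    ultimately show "y \<in> a_r_coset M K (r \<odot>\<^bsub>M\<^esub> u)" by (auto simp: a_r_coset_def')
  next
    fix y assume "y \<in> a_r_coset M K (r \<odot>\<^bsub>M\<^esub> u)"
    then obtain k where "k \<in> K" "y = k \<oplus>\<^bsub>M\<^esub> (r \<odot>\<^bsub>M\<^esub> u)" by (auto simp: a_r_coset_def')
    then show "y \<in> set_add M K ((\<lambda>x. r \<odot>\<^bsub>M\<^esub> x) ` (a_r_coset M K u))"
      using K.a_rcos_self[OF u] by (auto simp: set_add_def')
  qed
  then show "a_r_coset M K \<in> rmod_hom R M (quot_module M K)"
    by (auto simp: rmod_hom_def carrier_quot_module) (auto simp: quot_module_def K.a_rcos_sum)
  show "x \<in> carrier M \<Longrightarrow> a_r_coset M K x = \<zero>\<^bsub>quot_module M K\<^esub> \<longleftrightarrow> x \<in> K"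
    using K.a_rcos_self[of x] K.a_rcos_const[of x] by (auto simp: quot_module_def)
qed

end

section \<open>Additivity and continuity of a length function\<close>

context right_module
begin

lemma submodule_zero: "submodule {\<zero>\<^bsub>M\<^esub>} R M"
proof -
  have "r \<odot>\<^bsub>M\<^esub> \<zero>\<^bsub>M\<^esub> = \<zero>\<^bsub>M\<^esub>" if "r \<in> carrier R" for r
    using rsmult_r_distr[of r "\<zero>\<^bsub>M\<^esub>" "\<zero>\<^bsub>M\<^esub>"] that by simp
  then show ?thesis by (simp add: submodule_iff)
qed

text \<open>Additivity on the short exact sequence formed by the kernel of \<open>g\<close> on
  \<open>F\<close>, the submodule \<open>F\<close> and its image.\<close>

lemma length_image:
  assumes L: "length_function R L" and Q: "right_module R Q" and g: "g \<in> rmod_hom R M Q"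
    and F: "submodule F R M"
  shows "L (sub_module M F) = L (sub_module M {x \<in> F. g x = \<zero>\<^bsub>Q\<^esub>}) + L (sub_module Q (g ` F))"
proof -
  interpret Q: right_module R Q by fact
  let ?K = "{x \<in> F. g x = \<zero>\<^bsub>Q\<^esub>}"
  have Fc: "F \<subseteq> carrier M" using F by (simp add: submodule_iff)
  have "submodule {\<zero>\<^bsub>Q\<^esub>} R Q" by (rule Q.submodule_zero)
  then have "submodule {x \<in> carrier M. g x \<in> {\<zero>\<^bsub>Q\<^esub>}} R M"
    by (rule hom_preimage_submodule[OF Q g])
  then have "submodule (F \<inter> {x \<in> carrier M. g x \<in> {\<zero>\<^bsub>Q\<^esub>}}) R M"
    by (rule submodule_Int[OF F])
  moreover have "F \<inter> {x \<in> carrier M. g x \<in> {\<zero>\<^bsub>Q\<^esub>}} = ?K" using Fc by auto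
  ultimately have K: "submodule ?K R M" by simp
  \<comment> \<open>The inclusion of the kernel into \<open>F\<close> is represented by
    \<open>id\<close>.\<close>
  have "id \<in> rmod_hom R (sub_module M ?K) (sub_module M F)" by (auto simp: rmod_hom_def)
  moreover have "id ` carrier (sub_module M ?K) =
      {x \<in> carrier (sub_module M F). g x = \<zero>\<^bsub>sub_module Q (g ` F)\<^esub>}" by simp
  moreover have "g ` carrier (sub_module M F) = carrier (sub_module Q (g ` F))" by simp
  ultimately show ?thesis
    using L[unfolded length_function_def, THEN conjunct2, THEN conjunct2, THEN conjunct1, rule_format,
        OF right_module_sub[OF K] right_module_sub[OF F]
          Q.right_module_sub[OF hom_image_submodule[OF Q g F]] _ hom_restrict[OF g F] inj_on_id]
    by blast
qed

lemma length_iso: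
  assumes "length_function R L" "right_module R Q" "g \<in> rmod_hom R M Q"
    "inj_on g (carrier M)" "submodule F R M"
  shows "L (sub_module Q (g ` F)) = L (sub_module M F)"
proof -
  interpret Q: right_module R Q by fact
  have "F \<subseteq> carrier M" using assms(5) by (simp add: submodule_iff)
  then have "rmod_iso R (sub_module M F) (sub_module Q (g ` F))"
    using hom_restrict[OF assms(3,5)] inj_on_subset[OF assms(4)]
    by (auto simp: rmod_iso_def bij_betw_def)
  then show ?thesis
    using assms(1) right_module_sub[OF assms(5)]
      Q.right_module_sub[OF hom_image_submodule[OF assms(2,3,5)]]
    unfolding length_function_def by metis
qed

lemma length_eq_Sup:
  "length_function R L \<Longrightarrow> L M = Sup {L (sub_module M F) | F. fin_gen_submodule R M F}"
  by (drule length_function_def[THEN iffD1, THEN conjunct2, THEN conjunct2, THEN conjunct2, rule_format,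
        OF _ right_module_axioms])

text \<open>\<open>L\<close> accepts only modules with carrier in \<open>'m\<close>, so the quotient
  is replaced by an isomorphic copy \<open>Q\<close>. Composing the coset map with the isomorphism
  gives a surjection with kernel \<open>K\<close>, which is all that later arguments use of the
  quotient.\<close>

lemma quot_copy:
  fixes L :: "('r, 'm) module \<Rightarrow> ennreal"
  assumes L: "length_function R L" and K: "submodule K R M"
  obtains Q :: "('r, 'm) module" and g where "right_module R Q" "g \<in> rmod_hom R M Q"
    "g ` carrier M = carrier Q" "\<And>x. x \<in> carrier M \<Longrightarrow> g x = \<zero>\<^bsub>Q\<^esub> \<longleftrightarrow> x \<in> K"
    "length_of R L (quot_module M K) = L Q"
proof -
  let ?C = "quot_module M K"
  have C: "right_module R ?C" by (rule right_module_quot[OF right_module_axioms K])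
  interpret C: right_module R ?C by (rule C)
  obtain Q :: "('r, 'm) module" where Q: "right_module R Q" "rmod_iso R ?C Q"
    using quot_module_copy[OF right_module_axioms K] by blast
  obtain h where h: "h \<in> rmod_hom R ?C Q" "bij_betw h (carrier ?C) (carrier Q)"
    using Q(2) by (auto simp: rmod_iso_def)
  let ?g = "\<lambda>x. h (a_r_coset M K x)"
  have hz: "h X = \<zero>\<^bsub>Q\<^esub> \<longleftrightarrow> X = \<zero>\<^bsub>?C\<^esub>" if "X \<in> carrier ?C" for X
    using C.hom_zero[OF Q(1) h(1)] inj_onD[of h "carrier ?C" X "\<zero>\<^bsub>?C\<^esub>"] h(2) that
    by (auto simp: bij_betw_def)
  have rc: "a_r_coset M K x \<in> carrier ?C" if "x \<in> carrier M" for x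
    using that by (simp add: carrier_quot_module)
  show thesis
  proof (rule that[OF Q(1), of ?g])
    show "?g \<in> rmod_hom R M Q"
      using quot_module_hom(1)[OF K] h(1) rc by (simp add: rmod_hom_def Pi_iff)
    show "?g ` carrier M = carrier Q"
      using h(2) by (auto simp: bij_betw_def carrier_quot_module image_image)
    show "?g x = \<zero>\<^bsub>Q\<^esub> \<longleftrightarrow> x \<in> K" if "x \<in> carrier M" for x
      using hz[OF rc[OF that]] quot_module_hom(2)[OF K that] by simp
    show "length_of R L ?C = L Q" by (rule length_of_eq[OF L C Q])
  qed
qed

text \<open>By the second isomorphism theorem, \<open>N/K \<cong> F/(F \<inter> K)\<close> if \<open>N = F + K\<close>.\<close>

lemma length_quot_add:
  fixes L :: "('r, 'm) module \<Rightarrow> ennreal"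
  assumes L: "length_function R L" and F: "submodule F R M" and K: "submodule K R M"
    and N: "submodule N R M" "N = set_add M F K"
  shows "L (sub_module M F) =
    L (sub_module M (F \<inter> K)) + length_of R L (quot_module (sub_module M N) K)"
proof -
  interpret N: right_module R "sub_module M N" by (rule right_module_sub[OF N(1)])
  have sub: "F \<subseteq> N" "K \<subseteq> N" using set_add_superset[OF F K] N(2) by auto
  have FN: "submodule F R (sub_module M N)" and KN: "submodule K R (sub_module M N)"
    using F K sub submodule_sub_module_iff[OF N(1)] by auto
  obtain Q :: "('r, 'm) module" and g where Q: "right_module R Q"
    and g: "g \<in> rmod_hom R (sub_module M N) Q" "g ` N = carrier Q"
      "\<And>x. x \<in> N \<Longrightarrow> g x = \<zero>\<^bsub>Q\<^esub> \<longleftrightarrow> x \<in> K"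
      "length_of R L (quot_module (sub_module M N) K) = L Q"
    using N.quot_copy[OF L KN] by auto
  interpret Q: right_module R Q by (rule Q)
  \<comment> \<open>As \<open>N = F + K\<close> and \<open>g\<close> kills \<open>K\<close>, already
    \<open>F\<close> maps onto \<open>Q\<close>.\<close>
  have gF: "g ` F = carrier Q"
  proof
    show "g ` F \<subseteq> carrier Q" using g(2) sub by blast
    show "carrier Q \<subseteq> g ` F"
    proof
      fix y assume "y \<in> carrier Q"
      then obtain x where x: "x \<in> N" "y = g x" using g(2) by blast
      then obtain f k where fk: "f \<in> F" "k \<in> K" "x = f \<oplus>\<^bsub>M\<^esub> k"
        using N(2) by (auto simp: set_add_def')
      have "g x = g f \<oplus>\<^bsub>Q\<^esub> g k" using g(1) fk subsetD[OF sub(1)] subsetD[OF sub(2)] by (simp add: rmod_hom_def)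
      moreover have "g k = \<zero>\<^bsub>Q\<^esub>" using g(3)[of k] fk sub by blast
      moreover have "g f \<in> carrier Q" using g(2) fk sub by blast
      ultimately show "y \<in> g ` F" using x fk by auto
    qed
  qed
  have "{x \<in> F. g x = \<zero>\<^bsub>Q\<^esub>} = F \<inter> K" using g(3) sub by blast
  then show ?thesis using N.length_image[OF L Q g(1) FN] gF g(4) by simp
qed

text \<open>Upper continuity of \<open>L\<close> at \<open>N/K\<close> yields a finitely generated
  \<open>G\<close> of length above \<open>c\<close>; lifts of its generators span \<open>F\<close>,
  which maps onto \<open>G\<close> with kernel \<open>F \<inter> K\<close>. The number
  \<open>l\<close> is the length of \<open>F/(F \<inter> K)\<close>, given as a summand to avoid
  subtraction in \<open>ennreal\<close>.\<close>

lemma length_quot_approx: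
  fixes L :: "('r, 'm) module \<Rightarrow> ennreal"
  assumes L: "length_function R L" and K: "submodule K R M" and N: "submodule N R M" "K \<subseteq> N"
    and c: "c < length_of R L (quot_module (sub_module M N) K)"
  obtains F l where "fin_gen_submodule R M F" "F \<subseteq> N"
    "L (sub_module M F) = L (sub_module M (F \<inter> K)) + l" "c < l"
proof -
  interpret N: right_module R "sub_module M N" by (rule right_module_sub[OF N(1)])
  have KN: "submodule K R (sub_module M N)"
    using K N submodule_sub_module_iff[OF N(1)] by auto
  obtain Q :: "('r, 'm) module" and g where Q: "right_module R Q"
    and g: "g \<in> rmod_hom R (sub_module M N) Q" "g ` N = carrier Q"
      "\<And>x. x \<in> N \<Longrightarrow> g x = \<zero>\<^bsub>Q\<^esub> \<longleftrightarrow> x \<in> K"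
      "length_of R L (quot_module (sub_module M N) K) = L Q"
    using N.quot_copy[OF L KN] by auto
  interpret Q: right_module R Q by (rule Q)
  have "L Q = Sup {L (sub_module Q G) | G. fin_gen_submodule R Q G}"
    by (rule Q.length_eq_Sup[OF L])
  then obtain G where G: "fin_gen_submodule R Q G" "c < L (sub_module Q G)"
    using c g(4) by (auto simp: less_Sup_iff)
  then obtain S where S: "finite S" "S \<subseteq> g ` N" "G = submodule_span R Q S"
    using g(2) by (auto simp: fin_gen_submodule_def)
  then obtain S' where S': "S' \<subseteq> N" "finite S'" "S = g ` S'"
    by (meson finite_subset_image)
  let ?F = "submodule_span R M S'"
  have S'c: "S' \<subseteq> carrier M" using S' N by (auto simp: submodule_iff)
  have F: "submodule ?F R M" "?F \<subseteq> N"
    using submodule_span_submodule[OF S'c] submodule_span_minimal[OF N(1) S'(1)] by auto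
  then have FN: "submodule ?F R (sub_module M N)" using submodule_sub_module_iff[OF N(1)] by auto
  have "g ` ?F = G"
    using N.hom_image_span[OF Q g(1), of S'] S' S submodule_span_sub_module[OF N(1) S'(1)] by simp
  moreover have "{x \<in> ?F. g x = \<zero>\<^bsub>Q\<^esub>} = ?F \<inter> K" using g(3) F(2) by blast
  ultimately have "L (sub_module M ?F) = L (sub_module M (?F \<inter> K)) + L (sub_module Q G)"
    using N.length_image[OF L Q g(1) FN] by simp
  moreover have "fin_gen_submodule R M ?F" using S'(2) S'c by (auto simp: fin_gen_submodule_def)
  ultimately show thesis using that F(2) G(2) by blast
qed

lemma length_mono:
  fixes L :: "('r, 'm) module \<Rightarrow> ennreal"
  assumes "length_function R L" and F: "submodule F R M" and N: "submodule N R M" and "F \<subseteq> N"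
  shows "L (sub_module M F) \<le> L (sub_module M N)"
proof -
  \<comment> \<open>Writing \<open>N\<close> as \<open>N + F\<close> turns
    \<open>length_quot_add\<close> into additivity for the pair
    \<open>F \<subseteq> N\<close>.\<close>
  have "N = set_add M N F"
    using set_add_superset(1)[OF N F] set_add_minimal[OF N order_refl \<open>F \<subseteq> N\<close>] by blast
  from length_quot_add[OF assms(1) N F N this] \<open>F \<subseteq> N\<close> show ?thesis
    by (simp add: Int_absorb1)
qed

text \<open>A finite set of generators inside the union already lies in one member of the chain, so
  every finitely generated submodule of the union is bounded by some \<open>S n\<close>. Upper
  continuity then gives the limit.\<close>

lemma length_chain:
  fixes L :: "('r, 'm) module \<Rightarrow> ennreal"
  assumes L: "length_function R L" and S: "\<And>n. submodule (S n) R M" "incseq S"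
  shows "(\<lambda>n. L (sub_module M (S n))) \<longlonglongrightarrow> L (sub_module M (\<Union>n::nat. S n))"
proof -
  let ?U = "\<Union>n. S n"
  have U: "submodule ?U R M" by (rule submodule_chain_Union[OF S])
  interpret U: right_module R "sub_module M ?U" by (rule right_module_sub[OF U])
  have mono: "L (sub_module M (S m)) \<le> L (sub_module M (S n))" if "m \<le> n" for m n
    using length_mono[OF L S(1) S(1)] incseqD[OF S(2) that] by blast
  have "L (sub_module M ?U) = Sup {L (sub_module (sub_module M ?U) G) | G. fin_gen_submodule R (sub_module M ?U) G}"
    by (rule U.length_eq_Sup[OF L])
  also have "\<dots> \<le> (SUP n. L (sub_module M (S n)))"
  proof (rule Sup_least, clarify)
    fix G assume "fin_gen_submodule R (sub_module M ?U) G"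
    then obtain T where T: "finite T" "T \<subseteq> ?U" "G = submodule_span R M T"
      using submodule_span_sub_module[OF U] by (auto simp: fin_gen_submodule_def)
    have "\<exists>n. T \<subseteq> S n"
      using T(1,2)
    proof induction
      case (insert x T)
      then obtain m n where "x \<in> S m" "T \<subseteq> S n" by auto
      then have "insert x T \<subseteq> S (max m n)"
        using incseqD[OF S(2), of m "max m n"] incseqD[OF S(2), of n "max m n"] by auto
      then show ?case by blast
    qed simp
    then obtain n where n: "T \<subseteq> S n" by blast
    have "T \<subseteq> carrier M" using n S(1)[of n] by (auto simp: submodule_iff)
    then have "L (sub_module M G) \<le> L (sub_module M (S n))"
      using submodule_span_submodule submodule_span_minimal[OF S(1) n] T(3) length_mono[OF L _ S(1)]
      by blast
    then show "L (sub_module (sub_module M ?U) G) \<le> (SUP n. L (sub_module M (S n)))"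
      by (auto intro: SUP_upper2)
  qed
  finally have "L (sub_module M ?U) \<le> (SUP n. L (sub_module M (S n)))" .
  moreover have "(SUP n. L (sub_module M (S n))) \<le> L (sub_module M ?U)"
    by (intro SUP_least length_mono[OF L S(1) U]) blast
  ultimately have "(SUP n. L (sub_module M (S n))) = L (sub_module M ?U)" by simp
  then show ?thesis using LIMSEQ_SUP[of "\<lambda>n. L (sub_module M (S n))"] mono by (simp add: incseq_def)
qed

end

section \<open>Entropy of an automorphism\<close>

context right_module
begin

lemma
  assumes "rmod_automorphism R M \<phi>"
  shows mod_inv_hom: "mod_inv M \<phi> \<in> rmod_End R M"
    and mod_inv_right: "x \<in> carrier M \<Longrightarrow> \<phi> (mod_inv M \<phi> x) = x"
proof -
  let ?\<psi> = "mod_inv M \<phi>"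
  have f: "\<And>x. x \<in> carrier M \<Longrightarrow> \<phi> x \<in> carrier M"
    "\<And>x y. x \<in> carrier M \<Longrightarrow> y \<in> carrier M \<Longrightarrow> \<phi> (x \<oplus>\<^bsub>M\<^esub> y) = \<phi> x \<oplus>\<^bsub>M\<^esub> \<phi> y"
    "\<And>r x. r \<in> carrier R \<Longrightarrow> x \<in> carrier M \<Longrightarrow> \<phi> (r \<odot>\<^bsub>M\<^esub> x) = r \<odot>\<^bsub>M\<^esub> \<phi> x"
    and b: "bij_betw \<phi> (carrier M) (carrier M)"
    using assms by (auto simp: rmod_automorphism_def rmod_hom_def)
  have l: "?\<psi> (\<phi> x) = x" if "x \<in> carrier M" for x
    unfolding mod_inv_def using b that by (rule bij_betw_inv_into_left)
  show r: "\<phi> (?\<psi> x) = x" if "x \<in> carrier M" for x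
    unfolding mod_inv_def using b that by (rule bij_betw_inv_into_right)
  have c: "?\<psi> x \<in> carrier M" if "x \<in> carrier M" for x
    unfolding mod_inv_def using bij_betw_inv_into[OF b] that by (auto simp: bij_betw_def)
  have "?\<psi> (x \<oplus>\<^bsub>M\<^esub> y) = ?\<psi> x \<oplus>\<^bsub>M\<^esub> ?\<psi> y" if "x \<in> carrier M" "y \<in> carrier M" for x y
    using l[of "?\<psi> x \<oplus>\<^bsub>M\<^esub> ?\<psi> y"] f(2)[OF c c, OF that] r that c by simp
  moreover have "?\<psi> (a \<odot>\<^bsub>M\<^esub> x) = a \<odot>\<^bsub>M\<^esub> ?\<psi> x" if "a \<in> carrier R" "x \<in> carrier M" for a x
    using l[of "a \<odot>\<^bsub>M\<^esub> ?\<psi> x"] f(3)[OF that(1) c, OF that(2)] r that c by simp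
  ultimately show "?\<psi> \<in> rmod_End R M" using c by (simp add: rmod_hom_def)
qed

section \<open>Powers of an endomorphism and trajectories\<close>

lemma funpow_End: "f \<in> rmod_End R M \<Longrightarrow> f ^^ n \<in> rmod_End R M"
  by (induction n) (auto simp: rmod_hom_def Pi_iff)

lemma funpow_orbit_subset:
  assumes "f \<in> rmod_End R M" "F \<subseteq> carrier M"
  shows "(\<Union>i\<in>I. (f ^^ i) ` F) \<subseteq> carrier M"
proof -
  have "(f ^^ i) ` F \<subseteq> carrier M" for i
    using funpow_End[OF assms(1), of i] assms(2) by (auto simp: rmod_hom_def)
  then show ?thesis by blast
qed

lemma
  assumes "f \<in> rmod_End R M" "submodule F R M"
  shows submodule_traj_n: "submodule (traj_n R M n f F) R M"
    and submodule_traj: "submodule (traj R M f F) R M"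
proof -
  have "F \<subseteq> carrier M" using assms(2) by (simp add: submodule_iff)
  then show "submodule (traj_n R M n f F) R M" "submodule (traj R M f F) R M"
    unfolding traj_n_def traj_def
    by (auto simp del: UN_iff intro!: submodule_span_submodule funpow_orbit_subset[OF assms(1)])
qed

lemma traj_n_0: "traj_n R M 0 f F = {\<zero>\<^bsub>M\<^esub>}"
proof
  show "traj_n R M 0 f F \<subseteq> {\<zero>\<^bsub>M\<^esub>}"
    unfolding traj_n_def by (rule submodule_span_minimal[OF submodule_zero]) simp
  have "submodule (traj_n R M 0 f F) R M"
    unfolding traj_n_def by (rule submodule_span_submodule) simp
  then show "{\<zero>\<^bsub>M\<^esub>} \<subseteq> traj_n R M 0 f F" by (simp add: submodule_iff)
qed

text \<open>A span of a union is a sum of spans, and \<open>f\<close> commutes with spans. The index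
  set is left arbitrary so that finite and full trajectories are both covered.\<close>

lemma traj_step:
  assumes f: "f \<in> rmod_End R M" and F: "submodule F R M"
  shows "submodule_span R M (F \<union> f ` (\<Union>i\<in>I. (f ^^ i) ` F)) =
    set_add M F (f ` submodule_span R M (\<Union>i\<in>I. (f ^^ i) ` F))"
proof -
  have Fc: "F \<subseteq> carrier M" using F by (simp add: submodule_iff)
  note U = funpow_orbit_subset[OF f Fc, of I]
  have "f ` (\<Union>i\<in>I. (f ^^ i) ` F) \<subseteq> carrier M" using U f unfolding rmod_hom_def by blast
  then show ?thesis
    using submodule_span_Un[OF Fc] submodule_span_of_submodule[OF F]
      hom_image_span[OF right_module_axioms f U] by simp
qed

lemma traj_n_Suc:
  assumes "f \<in> rmod_End R M" "submodule F R M"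
  shows "traj_n R M (Suc n) f F = set_add M F (f ` traj_n R M n f F)"
proof -
  have "(\<Union>i<Suc n. (f ^^ i) ` F) = F \<union> f ` (\<Union>i<n. (f ^^ i) ` F)"
    unfolding lessThan_Suc_eq_insert_0 by (auto simp: image_UN image_image)
  then show ?thesis unfolding traj_n_def using traj_step[OF assms] by simp
qed

text \<open>Splitting off the index 0 leaves the shifted union. This fixed-point equation lets the
  second isomorphism theorem turn \<open>N/f N\<close> into \<open>F/(F \<inter> f N)\<close> for
  the trajectory \<open>N\<close> of \<open>F\<close>.\<close>

lemma traj_eq:
  assumes "f \<in> rmod_End R M" "submodule F R M"
  shows "traj R M f F = set_add M F (f ` traj R M f F)"
proof -
  have "(\<Union>i. (f ^^ i) ` F) = F \<union> f ` (\<Union>i. (f ^^ i) ` F)"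
    by (subst UNIV_nat_eq) (simp add: image_UN image_image)
  then show ?thesis unfolding traj_def using traj_step[OF assms, of UNIV] by simp
qed

lemma traj_image_subset:
  assumes "f \<in> rmod_End R M" "submodule F R M"
  shows "F \<subseteq> traj R M f F" "f ` traj R M f F \<subseteq> traj R M f F"
  using set_add_superset[OF assms(2) hom_image_submodule[OF right_module_axioms assms(1) submodule_traj[OF assms]]]
  unfolding traj_eq[OF assms, symmetric] by auto

lemma traj_minimal:
  assumes "submodule N R M" "f ` N \<subseteq> N" "F \<subseteq> N"
  shows "traj R M f F \<subseteq> N"
proof -
  have "(f ^^ i) ` F \<subseteq> N" for i
    by (induction i) (use assms in auto)
  then show ?thesis unfolding traj_def by (intro submodule_span_minimal[OF assms(1)]) auto
qed

text \<open>The trajectory is the least \<open>f\<close>-invariant submodule containing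
  \<open>N\<close>.\<close>

lemma eq_traj_iff:
  assumes "f \<in> rmod_End R M" "submodule N R M"
  shows "N = traj R M f N \<longleftrightarrow> f ` N \<subseteq> N"
  using traj_image_subset[OF assms] traj_minimal[OF assms(2) _ order_refl, of f]
  by (metis subset_antisym)

lemma traj_n_mono: "m \<le> n \<Longrightarrow> traj_n R M m f F \<subseteq> traj_n R M n f F"
  unfolding traj_n_def submodule_span_def by (intro Inter_anti_mono Collect_mono) fastforce

lemma traj_Union:
  assumes f: "f \<in> rmod_End R M" and F: "submodule F R M"
  shows "traj R M f F = (\<Union>n. traj_n R M n f F)"
proof
  have "(f ^^ i) ` F \<subseteq> traj_n R M (Suc i) f F" for i
    unfolding traj_n_def by (rule order_trans[OF _ submodule_span_superset]) blast
  then have "(\<Union>i. (f ^^ i) ` F) \<subseteq> (\<Union>n. traj_n R M n f F)" by blast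
  then show "traj R M f F \<subseteq> (\<Union>n. traj_n R M n f F)"
    unfolding traj_def
    by (intro submodule_span_minimal submodule_chain_Union submodule_traj_n[OF f F])
      (auto simp: incseq_def traj_n_mono)
  have "traj_n R M n f F \<subseteq> traj R M f F" for n
    unfolding traj_n_def traj_def submodule_span_def by (intro Inter_anti_mono Collect_mono) fastforce
  then show "(\<Union>n. traj_n R M n f F) \<subseteq> traj R M f F" by blast
qed

text \<open>\<open>\<phi>\<^sup>n\<close> maps \<open>F + \<phi>\<^sup>-\<^sup>1 F + \<dots> + \<phi>\<^sup>-\<^sup>n F\<close> onto \<open>\<phi>\<^sup>n F + \<dots> + F\<close>.\<close>

lemma length_traj_n_mod_inv:
  assumes L: "length_function R L" and a: "rmod_automorphism R M \<phi>" and F: "submodule F R M"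
  shows "L (sub_module M (traj_n R M n \<phi> F)) = L (sub_module M (traj_n R M n (mod_inv M \<phi>) F))"
proof (cases n)
  case 0
  then show ?thesis by (simp add: traj_n_0)
next
  \<comment> \<open>With \<open>n = Suc m\<close> the powers run from 0 to \<open>m\<close>, so
    \<open>\<phi> ^^ m\<close> is the map that carries one trajectory to the other.\<close>
  case (Suc m)
  let ?\<psi> = "mod_inv M \<phi>"
  have p: "\<phi> \<in> rmod_End R M" and b: "bij_betw \<phi> (carrier M) (carrier M)"
    using a by (auto simp: rmod_automorphism_def)
  note q = mod_inv_hom[OF a]
  have Fc: "F \<subseteq> carrier M" using F by (simp add: submodule_iff)
  have fc: "(f ^^ i) x \<in> carrier M" if "f \<in> rmod_End R M" "x \<in> carrier M" for f i x
    using funpow_End[OF that(1), of i] that(2) by (auto simp: rmod_hom_def)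
  have cancel: "(\<phi> ^^ i) ((?\<psi> ^^ i) x) = x" if "x \<in> carrier M" for i x
  proof (induction i)
    case (Suc i)
    \<comment> \<open>One factor of \<open>\<phi>\<close> is moved to the inside, where it meets the
      outermost \<open>\<psi>\<close> and cancels.\<close>
    have "(\<phi> ^^ Suc i) ((?\<psi> ^^ Suc i) x) = (\<phi> ^^ i) (\<phi> (?\<psi> ((?\<psi> ^^ i) x)))"
      unfolding funpow_Suc_right[of i \<phi>] by simp
    then show ?case using Suc fc[OF q that] by (simp add: mod_inv_right[OF a])
  qed simp
  have im: "(\<phi> ^^ m) ` (?\<psi> ^^ i) ` F = (\<phi> ^^ (m - i)) ` F" if "i \<le> m" for i
  proof -
    have "\<phi> ^^ m = (\<phi> ^^ (m - i)) \<circ> (\<phi> ^^ i)" using that by (simp flip: funpow_add)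
    then show ?thesis
      unfolding image_image using cancel Fc by (intro image_cong) auto
  qed
  have "(\<phi> ^^ m) ` (\<Union>i<n. (?\<psi> ^^ i) ` F) = (\<Union>i\<le>m. (\<phi> ^^ (m - i)) ` F)"
    unfolding image_UN Suc lessThan_Suc_atMost using im by auto
  also have "\<dots> = (\<Union>i<n. (\<phi> ^^ i) ` F)"
  proof -
    \<comment> \<open>The reflection of \<open>{..m}\<close> puts the powers back into increasing
      order.\<close>
    have "(\<lambda>i. m - i) ` {..m} = {..m}"
      by (auto simp: image_iff) (metis atMost_iff diff_diff_cancel diff_le_self)
    then have "(\<Union>i\<in>(\<lambda>i. m - i) ` {..m}. (\<phi> ^^ i) ` F) = (\<Union>i\<le>m. (\<phi> ^^ i) ` F)" by simp
    then show ?thesis by (simp add: Suc lessThan_Suc_atMost)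
  qed
  finally have "(\<phi> ^^ m) ` traj_n R M n ?\<psi> F = traj_n R M n \<phi> F"
    unfolding traj_n_def
    using hom_image_span[OF right_module_axioms funpow_End[OF p, of m] funpow_orbit_subset[OF q Fc, of "{..<n}"]]
    by simp
  moreover have "inj_on (\<phi> ^^ m) (carrier M)"
    using bij_betw_funpow[OF b] by (simp add: bij_betw_def)
  ultimately show ?thesis
    using length_iso[OF L right_module_axioms funpow_End[OF p, of m] _ submodule_traj_n[OF q F, of n]]
    by metis
qed

section \<open>Entropy along a single submodule\<close>

text \<open>The increments of \<open>L(T\<^sub>n)\<close> for \<open>\<psi>\<close> converge to
  \<open>L(N/\<psi> N)\<close>, hence so do the averages. The second conclusion states this
  additively, which allows two intersections with \<open>F\<close> to be compared later.\<close>

lemma ent_at_eq: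
  fixes L :: "('r, 'm) module \<Rightarrow> ennreal"
  assumes L: "length_function R L" and a: "rmod_automorphism R M \<phi>" and F: "F \<in> Fin_L R L M"
  defines "\<psi> \<equiv> mod_inv M \<phi>" and "N \<equiv> traj R M (mod_inv M \<phi>) F"
  shows "ent_at R L M \<phi> F = length_of R L (quot_module (sub_module M N) (\<psi> ` N))" (is "_ = ?q")
    and "L (sub_module M F) = L (sub_module M (F \<inter> \<psi> ` N)) + ent_at R L M \<phi> F"
proof -
  let ?l = "\<lambda>H. L (sub_module M H)"
  define T where "T n = traj_n R M n \<psi> F" for n
  have Fs: "submodule F R M" and Ff: "?l F < \<infinity>" using F by (auto simp: Fin_L_def)
  have q: "\<psi> \<in> rmod_End R M" unfolding \<psi>_def by (rule mod_inv_hom[OF a])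
  have inj: "inj_on \<psi> (carrier M)"
    unfolding \<psi>_def by (rule inj_on_inverseI) (rule mod_inv_right[OF a])
  have Ts: "submodule (T n) R M" and Ps: "submodule (\<psi> ` T n) R M" for n
    unfolding T_def using submodule_traj_n[OF q Fs] hom_image_submodule[OF right_module_axioms q] by auto
  have Ns: "submodule N R M" unfolding N_def \<psi>_def[symmetric] by (rule submodule_traj[OF q Fs])
  then have PNs: "submodule (\<psi> ` N) R M" by (rule hom_image_submodule[OF right_module_axioms q])
  have Tinc: "incseq T" unfolding T_def incseq_def using traj_n_mono by blast
  \<comment> \<open>The intersections with \<open>F\<close> exhaust
    \<open>F \<inter> \<psi> N\<close>, so \<open>length_chain\<close> supplies their limit.\<close>
  have U: "(\<Union>n. F \<inter> \<psi> ` T n) = F \<inter> \<psi> ` N"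
    unfolding N_def \<psi>_def[symmetric] T_def traj_Union[OF q Fs] by blast
  have lim: "(\<lambda>n. ?l (F \<inter> \<psi> ` T n)) \<longlonglongrightarrow> ?l (F \<inter> \<psi> ` N)"
    unfolding U[symmetric]
    by (rule length_chain[OF L submodule_Int[OF Fs Ps]]) (use Tinc in \<open>auto simp: incseq_def subset_iff\<close>)
  have fq: "?l F = ?l (F \<inter> \<psi> ` N) + ?q"
    using length_quot_add[OF L Fs PNs Ns] traj_eq[OF q Fs] unfolding N_def \<psi>_def by simp
  \<comment> \<open>The number \<open>d\<close> is the length of \<open>T (Suc n)\<close> modulo
    \<open>\<psi>\<close> T n\<open>, computed once from\<close>T (Suc n) = F + \<psi> T
    n\<open>and once from the inclusion of\<close>\<psi> \<open>T n\<close>. Naming it avoids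
    differences in \<open>ennreal\<close>.\<close>
  have step: "\<exists>d. ?l F = ?l (F \<inter> \<psi> ` T n) + d \<and> ?l (T (Suc n)) = ?l (T n) + d" for n
  proof -
    have S: "T (Suc n) = set_add M F (\<psi> ` T n)" unfolding T_def by (rule traj_n_Suc[OF q Fs])
    have "?l (\<psi> ` T n) = ?l (T n)" by (rule length_iso[OF L right_module_axioms q inj Ts])
    moreover have "\<psi> ` T n \<subseteq> T (Suc n)" using set_add_superset[OF Fs Ps] S by simp
    moreover have "T (Suc n) = set_add M (T (Suc n)) (\<psi> ` T n)"
      using set_add_superset(1)[OF Ts Ps] set_add_minimal[OF Ts order_refl \<open>\<psi> ` T n \<subseteq> T (Suc n)\<close>] by blast
    ultimately show ?thesis
      using length_quot_add[OF L Fs Ps Ts S] length_quot_add[OF L Ts Ps Ts]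
      by (metis inf.absorb2)
  qed
  have Tf: "?l (T n) < \<infinity>" for n
  proof (induction n)
    case 0
    have "T 0 \<subseteq> F" using Fs by (simp add: T_def traj_n_0 submodule_iff)
    from length_mono[OF L Ts Fs this] Ff show ?case by (rule le_less_trans)
  next
    case (Suc n)
    obtain d where d: "?l F = ?l (F \<inter> \<psi> ` T n) + d" "?l (T (Suc n)) = ?l (T n) + d"
      using step by blast
    then show ?case using Suc Ff by (simp add: less_top)
  qed
  have If: "?l (F \<inter> \<psi> ` T n) < \<infinity>" for n
    using length_mono[OF L submodule_Int[OF Fs Ps] Fs] Ff by (rule le_less_trans) simp
  have qf: "?q < \<infinity>" and If': "?l (F \<inter> \<psi> ` N) < \<infinity>" using Ff unfolding fq by (auto simp: less_top)
  \<comment> \<open>All lengths involved are now known to be finite, so increments can be formed in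
    the reals.\<close>
  define t where "t n = enn2real (?l (T n))" for n
  have "t (Suc n) - t n = enn2real (?l F) - enn2real (?l (F \<inter> \<psi> ` T n))" for n
  proof -
    obtain d where d: "?l F = ?l (F \<inter> \<psi> ` T n) + d" "?l (T (Suc n)) = ?l (T n) + d"
      using step by blast
    moreover have "d < \<infinity>" using d Ff by (simp add: less_top)
    ultimately show ?thesis using Tf If by (simp add: t_def enn2real_add)
  qed
  moreover have "(\<lambda>n. enn2real (?l F) - enn2real (?l (F \<inter> \<psi> ` T n))) \<longlonglongrightarrow>
      enn2real (?l F) - enn2real (?l (F \<inter> \<psi> ` N))"
    using lim If' by (intro tendsto_diff tendsto_const tendsto_enn2real) auto
  moreover have "enn2real (?l F) - enn2real (?l (F \<inter> \<psi> ` N)) = enn2real ?q"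
    using If' qf by (simp add: fq enn2real_add)
  ultimately have "(\<lambda>n. t n / real n) \<longlonglongrightarrow> enn2real ?q" using cesaro_increments by simp
  then have "(\<lambda>n. ennreal (t n / real n)) \<longlonglongrightarrow> ennreal (enn2real ?q)" by (rule tendsto_ennrealI)
  \<comment> \<open>\<open>divide_ennreal\<close> needs a positive denominator; the term at 0 does
    not affect the limit.\<close>
  moreover have "ennreal (t n / real n) = ?l (T n) / of_nat n" if "n > 0" for n
    using that Tf[of n] divide_ennreal[of "t n" "real n"]
    by (simp add: t_def ennreal_of_nat_eq_real_of_nat)
  then have "\<forall>\<^sub>F n in sequentially. ennreal (t n / real n) = ?l (T n) / of_nat n"
    by (auto simp: eventually_sequentially intro!: exI[of _ 1])
  ultimately have "(\<lambda>n. ?l (T n) / of_nat n) \<longlonglongrightarrow> ennreal (enn2real ?q)"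
    by (rule Lim_transform_eventually)
  then have "(\<lambda>n. ?l (T n) / of_nat n) \<longlonglongrightarrow> ?q" using qf by simp
  then show e: "ent_at R L M \<phi> F = ?q"
    unfolding ent_at_def length_traj_n_mod_inv[OF L a Fs] T_def \<psi>_def by (rule limI)
  show "?l F = ?l (F \<inter> \<psi> ` N) + ent_at R L M \<phi> F" unfolding e by (rule fq)
qed

end

section \<open>Recovering a module from its polynomial module\<close>

text \<open>Evaluating the action of constants and of \<open>X\<close> recovers the scalar action and \<open>\<phi>\<close>. Over the
  zero ring \<open>X = 0\<close>, but there every module is trivial.\<close>

lemma poly_module_eqD:
  assumes M: "right_module R M" and M': "right_module R M'"
    and p: "\<phi> \<in> rmod_End R M" and p': "\<phi>' \<in> rmod_End R M'"
    and eq: "poly_module R M \<phi> = poly_module R M' \<phi>'"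
  shows "carrier M' = carrier M" "\<zero>\<^bsub>M'\<^esub> = \<zero>\<^bsub>M\<^esub>" "add M' = add M"
    and "\<lbrakk>r \<in> carrier R; x \<in> carrier M\<rbrakk> \<Longrightarrow> r \<odot>\<^bsub>M'\<^esub> x = r \<odot>\<^bsub>M\<^esub> x"
    and "x \<in> carrier M \<Longrightarrow> \<phi>' x = \<phi> x"
proof -
  interpret M: right_module R M by fact
  interpret M': right_module R M' by fact
  interpret UP: UP_ring R "UP R" by unfold_locales
  show C: "carrier M' = carrier M" and "\<zero>\<^bsub>M'\<^esub> = \<zero>\<^bsub>M\<^esub>" "add M' = add M"
    using eq by (auto simp: poly_module_def)
  have act: "(\<Oplus>\<^bsub>M\<^esub>i\<in>{..deg R p}. (\<phi> ^^ i) (coeff (UP R) p i \<odot>\<^bsub>M\<^esub> x)) =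
      (\<Oplus>\<^bsub>M'\<^esub>i\<in>{..deg R p}. (\<phi>' ^^ i) (coeff (UP R) p i \<odot>\<^bsub>M'\<^esub> x))" for p x
    using eq unfolding poly_module_def by (simp add: fun_eq_iff)
  show "r \<odot>\<^bsub>M'\<^esub> x = r \<odot>\<^bsub>M\<^esub> x" if "r \<in> carrier R" "x \<in> carrier M" for r x
  proof -
    have "x \<in> carrier M'" using that C by simp
    then show ?thesis using act[of "monom (UP R) r 0" x] that by simp
  qed
  have c: "\<phi> x \<in> carrier M" "\<phi>' x \<in> carrier M'" if "x \<in> carrier M" for x
    using p p' C that by (auto simp: rmod_hom_def)
  show "\<phi>' x = \<phi> x" if x: "x \<in> carrier M" for x
  proof (cases "\<one>\<^bsub>R\<^esub> = \<zero>\<^bsub>R\<^esub>")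
    case True
    have "y = \<zero>\<^bsub>M\<^esub>" if "y \<in> carrier M" for y
      using M.rsmult_one[OF that] M.zero_smult[OF that] True by simp
    then show ?thesis using c[OF x] C by metis
  next
    case False
    have x': "x \<in> carrier M'" using x C by simp
    \<comment> \<open>For nonzero \<open>\<one>\<close> the polynomial \<open>X\<close> has degree
      1, so its action is a sum of two terms. The term at 0 has coefficient zero and the other is
      the image of \<open>x\<close>.\<close>
    have "{..Suc 0} = {0, Suc 0}" by auto
    then show ?thesis
      using act[of "monom (UP R) \<one>\<^bsub>R\<^esub> 1" x] x x' c[OF x] False
        M.hom_zero[OF M p] M'.hom_zero[OF M' p']
      by (simp add: M.zero_smult M'.zero_smult UP.deg_monom Pi_iff)
  qed
qed

text \<open>Membership only provides some \<open>M'\<close> and \<open>\<phi>'\<close> with the same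
  polynomial module. They agree with \<open>M\<close> and \<open>\<phi>\<close> on the carriers but
  may differ elsewhere, so both properties have to be transferred.\<close>

lemma lFin_X_invD:
  assumes L: "length_function R L" and M: "right_module R M" and p: "\<phi> \<in> rmod_End R M"
    and "poly_module R M \<phi> \<in> lFin_X_inv R L"
  shows "rmod_automorphism R M \<phi>" "locally_L_finite R L M"
proof -
  interpret M: right_module R M by fact
  obtain M' \<phi>' where M': "right_module R M'" and a: "rmod_automorphism R M' \<phi>'"
    and l: "locally_L_finite R L M'" and eq: "poly_module R M \<phi> = poly_module R M' \<phi>'"
    using assms(4) by (auto simp: lFin_X_inv_def)
  interpret M': right_module R M' by fact
  have p': "\<phi>' \<in> rmod_End R M'" using a by (simp add: rmod_automorphism_def)
  note e = poly_module_eqD[OF M M' p p' eq]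
  have "bij_betw \<phi> (carrier M) (carrier M) \<longleftrightarrow> bij_betw \<phi>' (carrier M) (carrier M)"
    by (rule bij_betw_cong) (simp add: e)
  then show "rmod_automorphism R M \<phi>" using a p e(1) by (simp add: rmod_automorphism_def)
  have sub: "submodule H R M' \<longleftrightarrow> submodule H R M" for H
    unfolding M.submodule_iff M'.submodule_iff e(1-3) using e(4) by (auto simp: subset_iff)
  show "locally_L_finite R L M"
    unfolding locally_L_finite_def
  proof (intro allI impI)
    fix F assume F: "fin_gen_submodule R M F"
    then have F': "fin_gen_submodule R M' F"
      by (simp add: fin_gen_submodule_def submodule_span_def sub e(1))
    have Fs: "submodule F R M"
      using F M.submodule_span_submodule by (auto simp: fin_gen_submodule_def)
    \<comment> \<open>The records may be different arguments of \<open>L\<close>; the identity is an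
      isomorphism between them, and \<open>L\<close> is invariant under it.\<close>
    have "id \<in> rmod_hom R M M'" using e by (simp add: rmod_hom_def)
    then have "L (sub_module M' (id ` F)) = L (sub_module M F)"
      by (rule M.length_iso[OF L M' _ inj_on_id Fs])
    then show "L (sub_module M F) < \<infinity>" using l[unfolded locally_L_finite_def, rule_format, OF F'] by simp
  qed
qed

section \<open>Entropy as a supremum over submodules invariant under the inverse\<close>

theorem proposition5p2:
  fixes R :: "('r, 'b) ring_scheme"
    and L :: "('r, 'm) module \<Rightarrow> ennreal"
    and M :: "('r, 'm) module"
    and \<phi> :: "'m \<Rightarrow> 'm"
  assumes "ring R"
    and "length_function R L"
    and "right_module R M"
    and "\<phi> \<in> rmod_End R M"
    and "poly_module R M \<phi> \<in> lFin_X_inv R L"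
  shows "ent R L M \<phi> =
    Sup {length_of R L (quot_module (sub_module M N) (mod_inv M \<phi> ` N)) | N.
      submodule N R M \<and> N = traj R M (mod_inv M \<phi>) N \<and>
      length_of R L (quot_module (sub_module M N) (mod_inv M \<phi> ` N)) < \<infinity>}"
    (is "_ = Sup ?S")
proof -
  note L = assms(2)
  interpret M: right_module R M by fact
  let ?l = "\<lambda>H. L (sub_module M H)"
  let ?\<psi> = "mod_inv M \<phi>"
  let ?q = "\<lambda>N. length_of R L (quot_module (sub_module M N) (?\<psi> ` N))"
  have a: "rmod_automorphism R M \<phi>" and lf: "locally_L_finite R L M"
    using lFin_X_invD[OF L assms(3-5)] by auto
  have \<psi>: "?\<psi> \<in> rmod_End R M" by (rule M.mod_inv_hom[OF a])
  show ?thesis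
  proof (rule antisym)
    show "ent R L M \<phi> \<le> Sup ?S"
      unfolding ent_def
    proof (rule Sup_mono, clarify)
      fix F assume F: "F \<in> Fin_L R L M"
      let ?N = "traj R M ?\<psi> F"
      have Fs: "submodule F R M" and "?l F < \<infinity>" using F by (auto simp: Fin_L_def)
      then have fin: "ent_at R L M \<phi> F < \<infinity>"
        unfolding M.ent_at_eq(2)[OF L a F] by (simp add: less_top)
      have N: "submodule ?N R M" by (rule M.submodule_traj[OF \<psi> Fs])
      have inv: "?N = traj R M ?\<psi> ?N"
        using M.eq_traj_iff[OF \<psi> N] M.traj_image_subset(2)[OF \<psi> Fs] by blast
      \<comment> \<open>The trajectory of \<open>F\<close> is the witness: it is invariant, and its
        quotient has finite length because \<open>F\<close> does.\<close>
      have "ent_at R L M \<phi> F \<in> ?S"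
        using M.ent_at_eq(1)[OF L a F] N inv fin by (intro CollectI exI[of _ ?N]) simp
      then show "\<exists>q\<in>?S. ent_at R L M \<phi> F \<le> q" by blast
    qed
    show "Sup ?S \<le> ent R L M \<phi>"
    proof (rule Sup_least, clarify)
      fix N assume N: "submodule N R M" and "N = traj R M ?\<psi> N"
      then have inv: "?\<psi> ` N \<subseteq> N" using M.eq_traj_iff[OF \<psi> N] by blast
      have K: "submodule (?\<psi> ` N) R M" by (rule M.hom_image_submodule[OF assms(3) \<psi> N])
      show "?q N \<le> ent R L M \<phi>"
      \<comment> \<open>The length of the quotient is only approximated by finitely generated
        pieces, so an arbitrary \<open>c\<close> below it is treated.\<close>
      proof (rule dense_le)
        fix c assume "c < ?q N"
        then obtain F l where fg: "fin_gen_submodule R M F" and FN: "F \<subseteq> N"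
          and l: "?l F = ?l (F \<inter> ?\<psi> ` N) + l" "c < l"
          using M.length_quot_approx[OF L K N inv] by blast
        have Fs: "submodule F R M"
          using fg M.submodule_span_submodule by (auto simp: fin_gen_submodule_def)
        have Ff: "?l F < \<infinity>" using lf fg by (simp add: locally_L_finite_def)
        \<comment> \<open>Local finiteness makes \<open>F\<close> a competitor in the supremum
          defining the entropy.\<close>
        have F: "F \<in> Fin_L R L M" using Fs Ff by (simp add: Fin_L_def)
        let ?K' = "?\<psi> ` traj R M ?\<psi> F"
        have K': "submodule ?K' R M"
          by (rule M.hom_image_submodule[OF assms(3) \<psi> M.submodule_traj[OF \<psi> Fs]])
        have "?K' \<subseteq> ?\<psi> ` N" by (intro image_mono M.traj_minimal[OF N inv FN])
        then have "F \<inter> ?K' \<subseteq> F \<inter> ?\<psi> ` N" by blast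
        \<comment> \<open>\<open>L(F)\<close> decomposes along both intersections; the smaller one
          leaves the larger remainder.\<close>
        from M.length_mono[OF L M.submodule_Int[OF Fs K'] M.submodule_Int[OF Fs K] this]
        have "?l (F \<inter> ?\<psi> ` N) + l \<le> ?l (F \<inter> ?\<psi> ` N) + ent_at R L M \<phi> F"
          using M.ent_at_eq(2)[OF L a F] l(1) by (metis add_right_mono)
        \<comment> \<open>Cancellation in \<open>ennreal\<close> needs this summand to be finite;
          \<open>L(F)\<close> bounds it.\<close>
        moreover have "?l (F \<inter> ?\<psi> ` N) < \<infinity>" using Ff unfolding l(1) by (simp add: less_top)
        ultimately have "l \<le> ent_at R L M \<phi> F" by (auto simp: ennreal_add_left_cancel_le)
        moreover have "ent_at R L M \<phi> F \<le> ent R L M \<phi>"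
          unfolding ent_def using F by (auto intro: Sup_upper)
        ultimately show "c \<le> ent R L M \<phi>" using l(2) by simp
      qed
    qed
  qed
qed

end
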